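(* Let $q,m,k,s_1,\ldots,s_u$ be positive integers such that $q$ is a prime power and $m\leq q$. Assume that there exist a weighing matrix of order $m$ and weight $k$ and an orthogonal design of order $m$ and type $(s_1,\ldots,s_u)$. Then: (1) there exist $m$ mutually unbiased unit orthogonal designs of order $mq$ and type $(ks_1,\ldots,ks_u)$ with parameter $\alpha=k^2$; (2) for every nonempty subset $S\subseteq\{1,\ldots,u\}$ there exist $m$ mutually quasi-unbiased unit weighing matrices for the parameters $\left(mq,\;k\sum_{i\in S}s_i,\;k^2,\;(\sum_{i\in S}s_i)^2\right)$.
   Context: Let $\mathbb{T}=\{c\in\mathbb{C}:|c|=1\}$ and let $W^*$ denote the conjugate transpose. A weighing matrix of order $n$ and weight $k$ is an $n\times n$ $(0,1,-1)$-matrix $W$ with $WW^\top=kI_n$; an orthogonal design of order $n$ and type $(s_1,\ldots,s_u)$ in distinct commuting real indeterminates $x_1,\ldots,x_u$ is an $n\times n$ matrix $D$ with entries in $\{0,\pm x_1,\ldots,\pm x_u\}$ with $DD^\top=(s_1x_1^2+\cdots+s_ux_u^2)I_n$. A unit weighing matrix of order $n$ and weight $k$ is an $n\times n$ matrix $W$ with entries in $\{0\}\cup\mathbb{T}$ such that $WW^*=kI_n$. Two unit weighing matrices $W_1,W_2$ of order $n$ and weight $k$ are quasi-unbiased for parameters $(n,k,l,a)$ if $\frac1{\sqrt a}W_1W_2^*$ is a unit weighing matrix of order $n$ and weight $l$; a family is mutually quasi-unbiased if any two distinct members are. A unit orthogonal design of order $n$ and type $(s_1,\ldots,s_u)$ in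 variables $x_1,\ldots,x_u$ (distinct commuting real indeterminates) is an $n\times n$ matrix with entries in $\{0\}\cup\{\epsilon x_i: 1\le i\le u,\ \epsilon\in\mathbb{T}\}$ with $DD^*=(s_1x_1^2+\cdots+s_ux_u^2)I_n$. Two such designs $D_1,D_2$ (same order, type and variables) are unbiased with parameter $\alpha>0$ if there is an $n\times n$ matrix $W$ with entries in $\{0\}\cup\mathbb{T}$ such that $D_1D_2^*=\frac{s_1x_1^2+\cdots+s_ux_u^2}{\sqrt\alpha}W$; a family is mutually unbiased if any two distinct members are. *)

theory Defs
  imports Complex_Main "HOL-Number_Theory.Prime_Powers"
begin

text \<open>Matrices of order n are represented as functions nat => nat => _, only the
entries with indices below n being relevant.  A (unit) orthogonal design in the
variables x_1,...,x_u is represented by a coefficient matrix c and a variable-index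
matrix v: the (i,j) entry is c i j * x_(v i j).  Identities in the indeterminates are
expressed as identities for all real substitutions x :: nat => real (equivalent to
polynomial identities over the reals).\<close>

definition entry_unit_or_zero :: "complex \<Rightarrow> bool" where
  "entry_unit_or_zero z \<longleftrightarrow> z = 0 \<or> cmod z = 1"

definition mult_adj :: "nat \<Rightarrow> (nat \<Rightarrow> nat \<Rightarrow> complex) \<Rightarrow> (nat \<Rightarrow> nat \<Rightarrow> complex) \<Rightarrow> nat \<Rightarrow> nat \<Rightarrow> complex" where
  "mult_adj n A B i j = (\<Sum>l<n. A i l * cnj (B j l))"

definition weighing_matrix :: "nat \<Rightarrow> nat \<Rightarrow> (nat \<Rightarrow> nat \<Rightarrow> int) \<Rightarrow> bool" where
  "weighing_matrix n k W \<longleftrightarrow>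
     (\<forall>i<n. \<forall>j<n. W i j \<in> {-1, 0, 1}) \<and>
     (\<forall>i<n. \<forall>j<n. (\<Sum>l<n. W i l * W j l) = (if i = j then int k else 0))"

definition orthogonal_design ::
  "nat \<Rightarrow> nat \<Rightarrow> (nat \<Rightarrow> nat) \<Rightarrow> (nat \<Rightarrow> nat \<Rightarrow> int) \<Rightarrow> (nat \<Rightarrow> nat \<Rightarrow> nat) \<Rightarrow> bool" where
  "orthogonal_design n u s c v \<longleftrightarrow>
     (\<forall>i<n. \<forall>j<n. c i j \<in> {-1, 0, 1} \<and> v i j \<in> {1..u}) \<and>
     (\<forall>x :: nat \<Rightarrow> real. \<forall>i<n. \<forall>j<n.
        (\<Sum>l<n. (of_int (c i l) * x (v i l)) * (of_int (c j l) * x (v j l))) =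
        (if i = j then (\<Sum>t\<in>{1..u}. real (s t) * (x t)\<^sup>2) else 0))"

definition unit_weighing :: "nat \<Rightarrow> nat \<Rightarrow> (nat \<Rightarrow> nat \<Rightarrow> complex) \<Rightarrow> bool" where
  "unit_weighing n k W \<longleftrightarrow>
     (\<forall>i<n. \<forall>j<n. entry_unit_or_zero (W i j)) \<and>
     (\<forall>i<n. \<forall>j<n. mult_adj n W W i j = (if i = j then of_nat k else 0))"

definition quasi_unbiased :: "nat \<Rightarrow> nat \<Rightarrow> nat \<Rightarrow> real \<Rightarrow>
    (nat \<Rightarrow> nat \<Rightarrow> complex) \<Rightarrow> (nat \<Rightarrow> nat \<Rightarrow> complex) \<Rightarrow> bool" where
  "quasi_unbiased n k l a W1 W2 \<longleftrightarrow>
     unit_weighing n k W1 \<and> unit_weighing n k W2 \<and>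
     unit_weighing n l (\<lambda>i j. mult_adj n W1 W2 i j / of_real (sqrt a))"

definition mutually_quasi_unbiased :: "nat \<Rightarrow> nat \<Rightarrow> nat \<Rightarrow> nat \<Rightarrow> real \<Rightarrow>
    (nat \<Rightarrow> nat \<Rightarrow> nat \<Rightarrow> complex) \<Rightarrow> bool" where
  "mutually_quasi_unbiased m n k l a F \<longleftrightarrow>
     (\<forall>r<m. unit_weighing n k (F r)) \<and>
     (\<forall>r<m. \<forall>r'<m. r \<noteq> r' \<longrightarrow>
        (\<exists>i<n. \<exists>j<n. F r i j \<noteq> F r' i j) \<and> quasi_unbiased n k l a (F r) (F r'))"

definition design_eval :: "(nat \<Rightarrow> nat \<Rightarrow> complex) \<Rightarrow> (nat \<Rightarrow> nat \<Rightarrow> nat) \<Rightarrow> (nat \<Rightarrow> real)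
    \<Rightarrow> nat \<Rightarrow> nat \<Rightarrow> complex" where
  "design_eval c v x i j = c i j * of_real (x (v i j))"

definition design_form :: "nat \<Rightarrow> (nat \<Rightarrow> nat) \<Rightarrow> (nat \<Rightarrow> real) \<Rightarrow> real" where
  "design_form u s x = (\<Sum>t\<in>{1..u}. real (s t) * (x t)\<^sup>2)"

definition unit_orthogonal_design ::
  "nat \<Rightarrow> nat \<Rightarrow> (nat \<Rightarrow> nat) \<Rightarrow> (nat \<Rightarrow> nat \<Rightarrow> complex) \<Rightarrow> (nat \<Rightarrow> nat \<Rightarrow> nat) \<Rightarrow> bool" where
  "unit_orthogonal_design n u s c v \<longleftrightarrow>
     (\<forall>i<n. \<forall>j<n. entry_unit_or_zero (c i j) \<and> v i j \<in> {1..u}) \<and>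
     (\<forall>x :: nat \<Rightarrow> real. \<forall>i<n. \<forall>j<n.
        mult_adj n (design_eval c v x) (design_eval c v x) i j =
        (if i = j then of_real (design_form u s x) else 0))"

definition unbiased_designs ::
  "nat \<Rightarrow> nat \<Rightarrow> (nat \<Rightarrow> nat) \<Rightarrow> real \<Rightarrow> (nat \<Rightarrow> nat \<Rightarrow> complex) \<Rightarrow> (nat \<Rightarrow> nat \<Rightarrow> nat) \<Rightarrow>
    (nat \<Rightarrow> nat \<Rightarrow> complex) \<Rightarrow> (nat \<Rightarrow> nat \<Rightarrow> nat) \<Rightarrow> bool" where
  "unbiased_designs n u s \<alpha> c1 v1 c2 v2 \<longleftrightarrow>
     unit_orthogonal_design n u s c1 v1 \<and> unit_orthogonal_design n u s c2 v2 \<and> \<alpha> > 0 \<and>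
     (\<exists>W :: nat \<Rightarrow> nat \<Rightarrow> complex. (\<forall>i<n. \<forall>j<n. entry_unit_or_zero (W i j)) \<and>
        (\<forall>x :: nat \<Rightarrow> real. \<forall>i<n. \<forall>j<n.
           mult_adj n (design_eval c1 v1 x) (design_eval c2 v2 x) i j =
           of_real (design_form u s x / sqrt \<alpha>) * W i j))"

text \<open>A family of m pairwise distinct (as matrices over the indeterminates), mutually
unbiased unit orthogonal designs.\<close>
definition mutually_unbiased_designs ::
  "nat \<Rightarrow> nat \<Rightarrow> nat \<Rightarrow> (nat \<Rightarrow> nat) \<Rightarrow> real \<Rightarrow>
    (nat \<Rightarrow> nat \<Rightarrow> nat \<Rightarrow> complex) \<Rightarrow> (nat \<Rightarrow> nat \<Rightarrow> nat \<Rightarrow> nat) \<Rightarrow> bool" where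
  "mutually_unbiased_designs m n u s \<alpha> C V \<longleftrightarrow>
     (\<forall>r<m. unit_orthogonal_design n u s (C r) (V r)) \<and>
     (\<forall>r<m. \<forall>r'<m. r \<noteq> r' \<longrightarrow>
        (\<exists>x. \<exists>i<n. \<exists>j<n. design_eval (C r) (V r) x i j \<noteq> design_eval (C r') (V r') x i j) \<and>
        unbiased_designs n u s \<alpha> (C r) (V r) (C r') (V r'))"

end

theory Submission
  imports Defs "Jordan_Normal_Form.Char_Poly"
begin

text \<open>
Take m parallel classes of lines in the affine plane over the field with q elements, choosing
the classes so that an m by q grid of points meets every line in m points with distinct
second coordinates. If H is the weighing matrix and D the orthogonal design, let L_r be the matrix
of order mq whose row (i, b) carries the entry H i j at the j-th grid point of the b-th line of class
r. Lines of one class are disjoint and lines of different classes share at most one grid point, so L_r L_r^T = k I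
and L_r L_r'^T has entries 0, 1, -1. The designs are D_r = L_r (D \<otimes> I): their entries are monomials
because the second coordinates on a line are distinct, and D_r D_r'^T is the form of D times
L_r L_r'^T. Substituting the indicator function of S for the variables gives the second part.

The field is Z[z]/P, where z is a complex primitive root of unity of order q - 1 and P is a maximal ideal
containing the prime p that divides q. Frobenius gives x^q = x in the quotient, and x^q - x
splits as the product of x and all x - z^i, so 0 and the powers of z represent all residue classes.
\<close>

section \<open>A finite field inside the cyclotomic integers\<close>

text \<open>An eigenvalue of an integer matrix is a root of its characteristic polynomial, which is
  monic with integer coefficients. The nonzero entry at \<open>i\<^sub>0\<close> makes v an
  eigenvector.\<close>

lemma algebraic_int_eigenvalue:
  fixes x :: complex and v :: "nat \<Rightarrow> complex" and M :: "nat \<Rightarrow> nat \<Rightarrow> int"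
  assumes M: "\<And>i. i < n \<Longrightarrow> x * v i = (\<Sum>j<n. of_int (M i j) * v j)"
    and "i\<^sub>0 < n" "v i\<^sub>0 \<noteq> 0"
  shows "algebraic_int x"
proof -
  define A where "A = mat n n (\<lambda>(i, j). M i j)"
  have A: "A \<in> carrier_mat n n"
    by (simp add: A_def)
  let ?A = "map_mat of_int A :: complex mat"
  have "eigenvector ?A (vec n v) x"
    unfolding eigenvector_def
  proof (intro conjI)
    show "vec n v \<noteq> 0\<^sub>v (dim_row ?A)"
    proof
      assume "vec n v = 0\<^sub>v (dim_row ?A)"
      then have "vec n v $ i\<^sub>0 = 0\<^sub>v (dim_row ?A) $ i\<^sub>0"
        by simp
      then show False
        using assms(2,3) by (simp add: A_def)
    qed
    show "?A *\<^sub>v vec n v = x \<cdot>\<^sub>v vec n v"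
      by (rule eq_vecI) (auto simp: A_def scalar_prod_def M lessThan_atLeast0)
  qed (simp add: A_def)
  then have "poly (char_poly ?A) x = 0"
    using A eigenvalue_root_char_poly[of ?A n x] unfolding eigenvalue_def by auto
  then have "poly (map_poly of_int (char_poly A)) x = 0"
    by (simp add: of_int_hom.char_poly_hom[OF A])
  moreover have "lead_coeff (char_poly A) = 1"
    using degree_monic_char_poly[OF A] by simp
  ultimately show ?thesis
    unfolding algebraic_int_altdef_ipoly by blast
qed

section \<open>The ring Z[z] generated by a root of unity\<close>

text \<open>The inductive form of Z[z] lets integrality and the Frobenius identity be proved by
  induction over the ring operations; 0 arises as 1 + (-1).\<close>

inductive_set adjoin :: "complex \<Rightarrow> complex set" for z where
  one: "1 \<in> adjoin z"
| gen: "z \<in> adjoin z"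
| add: "x \<in> adjoin z \<Longrightarrow> y \<in> adjoin z \<Longrightarrow> x + y \<in> adjoin z"
| uminus: "x \<in> adjoin z \<Longrightarrow> - x \<in> adjoin z"
| mult: "x \<in> adjoin z \<Longrightarrow> y \<in> adjoin z \<Longrightarrow> x * y \<in> adjoin z"

definition subring :: "'a::comm_ring_1 set \<Rightarrow> bool" where
  "subring R \<longleftrightarrow> 1 \<in> R \<and> (\<forall>x\<in>R. - x \<in> R) \<and> (\<forall>x\<in>R. \<forall>y\<in>R. x + y \<in> R \<and> x * y \<in> R)"

lemma subring_adjoin: "subring (adjoin z)"
  by (auto simp: subring_def intro: adjoin.intros)

lemma subringD:
  assumes "subring R"
  shows "1 \<in> R" "0 \<in> R" "x \<in> R \<Longrightarrow> - x \<in> R" "x \<in> R \<Longrightarrow> y \<in> R \<Longrightarrow> x + y \<in> R"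
    "x \<in> R \<Longrightarrow> y \<in> R \<Longrightarrow> x * y \<in> R" "x \<in> R \<Longrightarrow> y \<in> R \<Longrightarrow> x - y \<in> R"
proof -
  have *: "1 \<in> R" "\<And>x. x \<in> R \<Longrightarrow> - x \<in> R" "\<And>x y. x \<in> R \<Longrightarrow> y \<in> R \<Longrightarrow> x + y \<in> R"
    "\<And>x y. x \<in> R \<Longrightarrow> y \<in> R \<Longrightarrow> x * y \<in> R"
    using assms by (auto simp: subring_def)
  show "0 \<in> R" using *(3)[OF *(1) *(2)[OF *(1)]] by simp
  show "x \<in> R \<Longrightarrow> y \<in> R \<Longrightarrow> x - y \<in> R" using *(3)[OF _ *(2), of x y] by simp
qed (use assms in \<open>auto simp: subring_def\<close>)

lemma subring_closed:
  assumes "subring R"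
  shows "(\<And>i. i \<in> A \<Longrightarrow> f i \<in> R) \<Longrightarrow> sum f A \<in> R" "x \<in> R \<Longrightarrow> x ^ n \<in> R" "of_nat n \<in> R"
proof -
  show "(\<And>i. i \<in> A \<Longrightarrow> f i \<in> R) \<Longrightarrow> sum f A \<in> R"
    by (induction A rule: infinite_finite_induct) (auto intro: subringD[OF assms])
  show "x \<in> R \<Longrightarrow> x ^ n \<in> R"
    by (induction n) (auto intro: subringD[OF assms])
  show "of_nat n \<in> R"
    by (induction n) (auto intro: subringD[OF assms])
qed

text \<open>Since z^n = 1, multiplication by an element of Z[z] maps the integer span of 1, z, ...,
  z^(n-1) into itself, and M records this action. The powers may be linearly dependent, so M need
  not be unique.\<close>

lemma adjoin_int_matrix:
  assumes "0 < n" "z ^ n = 1" "x \<in> adjoin z"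
  shows "\<exists>M :: nat \<Rightarrow> nat \<Rightarrow> int. \<forall>i<n. x * z ^ i = (\<Sum>j<n. of_int (M i j) * z ^ j)"
  using assms(3)
proof induction
  case one
  show ?case
    by (rule exI[of _ "\<lambda>i j. if j = i then 1 else 0"]) (simp add: if_distrib if_distribR cong: if_cong)
next
  case gen
  show ?case
  \<comment> \<open>Multiplication by z shifts the exponents cyclically.\<close>
  proof (rule exI[of _ "\<lambda>i j. if j = Suc i mod n then 1 else 0"], intro allI impI)
    fix i assume "i < n"
    have "z ^ (Suc i mod n) = z ^ Suc i"
    proof -
      have "z ^ Suc i = z ^ (n * (Suc i div n) + Suc i mod n)" by simp
      also have "\<dots> = z ^ (Suc i mod n)"
        by (simp only: power_add power_mult assms(2) power_one mult_1)
      finally show ?thesis ..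
    qed
    moreover have "Suc i mod n < n" using assms(1) by simp
    ultimately show "z * z ^ i = (\<Sum>j<n. of_int (if j = Suc i mod n then 1 else 0) * z ^ j)"
      by (simp add: if_distrib if_distribR cong: if_cong)
  qed
next
  case (add x y)
  then obtain M N :: "nat \<Rightarrow> nat \<Rightarrow> int" where
    "\<forall>i<n. x * z ^ i = (\<Sum>j<n. of_int (M i j) * z ^ j)"
    "\<forall>i<n. y * z ^ i = (\<Sum>j<n. of_int (N i j) * z ^ j)" by blast
  then show ?case
    by (intro exI[of _ "\<lambda>i j. M i j + N i j"]) (simp add: algebra_simps sum.distrib)
next
  case (uminus x)
  then obtain M :: "nat \<Rightarrow> nat \<Rightarrow> int" where
    "\<forall>i<n. x * z ^ i = (\<Sum>j<n. of_int (M i j) * z ^ j)" by blast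
  then show ?case
    by (intro exI[of _ "\<lambda>i j. - M i j"]) (simp add: sum_negf)
next
  case (mult x y)
  then obtain M N :: "nat \<Rightarrow> nat \<Rightarrow> int" where
    M: "\<forall>i<n. x * z ^ i = (\<Sum>j<n. of_int (M i j) * z ^ j)" and
    N: "\<forall>i<n. y * z ^ i = (\<Sum>j<n. of_int (N i j) * z ^ j)" by blast
  show ?case
  proof (rule exI[of _ "\<lambda>i j. \<Sum>l<n. N i l * M l j"], intro allI impI)
    fix i assume "i < n"
    then have "x * y * z ^ i = (\<Sum>l<n. of_int (N i l) * (x * z ^ l))"
      using N by (simp add: mult.assoc sum_distrib_left mult.left_commute)
    also have "\<dots> = (\<Sum>l<n. \<Sum>j<n. of_int (N i l * M l j) * z ^ j)"
      using M by (simp add: sum_distrib_left mult.assoc)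
    also have "\<dots> = (\<Sum>j<n. of_int (\<Sum>l<n. N i l * M l j) * z ^ j)"
      by (subst sum.swap) (simp add: sum_distrib_right)
    finally show "x * y * z ^ i = (\<Sum>j<n. of_int (\<Sum>l<n. N i l * M l j) * z ^ j)" .
  qed
qed

text \<open>An inverse of p in Z[z] would be a rational algebraic integer.\<close>

lemma nat_not_unit_adjoin:
  assumes "0 < n" "z ^ n = 1" "x \<in> adjoin z" "1 < p"
  shows "of_nat p * x \<noteq> 1"
proof
  assume eq: "of_nat p * x = 1"
  obtain M :: "nat \<Rightarrow> nat \<Rightarrow> int" where
    "\<forall>i<n. x * z ^ i = (\<Sum>j<n. of_int (M i j) * z ^ j)"
    using adjoin_int_matrix[OF assms(1-3)] by blast
  then have "algebraic_int x"
    using assms(1) by (intro algebraic_int_eigenvalue[of n x "\<lambda>i. z ^ i" M 0]) auto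
  moreover have "x = 1 / of_nat p"
    using eq assms(4) by (auto simp: field_simps)
  ultimately have "x \<in> \<int>"
    by (intro rational_algebraic_int_is_int) auto
  then obtain a where "x = of_int a" by (auto elim: Ints_cases)
  with eq have "of_int (int p * a) = (1 :: complex)" by simp
  then have "int p * a = 1" by (simp only: of_int_eq_1_iff)
  then have "int p dvd 1" by (metis dvd_triv_left)
  then show False using assms(4) by simp
qed

section \<open>Prime ideals and congruences\<close>

text \<open>The quotient is never formed: congruence modulo I is expressed as membership of a
  difference in I.\<close>

definition ideal_of :: "'a::comm_ring_1 set \<Rightarrow> 'a set \<Rightarrow> bool" where
  "ideal_of R I \<longleftrightarrow> I \<subseteq> R \<and> 0 \<in> I \<and> (\<forall>x\<in>I. \<forall>y\<in>I. x + y \<in> I) \<and> (\<forall>r\<in>R. \<forall>x\<in>I. r * x \<in> I)"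

lemma ideal_ofD:
  assumes "ideal_of R I" "subring R"
  shows "x \<in> I \<Longrightarrow> x \<in> R" "0 \<in> I" "x \<in> I \<Longrightarrow> y \<in> I \<Longrightarrow> x + y \<in> I" "r \<in> R \<Longrightarrow> x \<in> I \<Longrightarrow> r * x \<in> I"
    "x \<in> I \<Longrightarrow> - x \<in> I" "x \<in> I \<Longrightarrow> y \<in> I \<Longrightarrow> x - y \<in> I"
proof -
  have *: "x \<in> I \<Longrightarrow> - x \<in> I" for x
    using assms subringD(3)[OF assms(2) subringD(1)[OF assms(2)]]
    unfolding ideal_of_def by (metis mult_minus1)
  then show "x \<in> I \<Longrightarrow> - x \<in> I" .
  show "x \<in> I \<Longrightarrow> y \<in> I \<Longrightarrow> x - y \<in> I"
    using * assms(1) unfolding ideal_of_def by (metis add_uminus_conv_diff)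
qed (use assms in \<open>auto simp: ideal_of_def\<close>)

lemma ideal_of_sum:
  assumes "ideal_of R I" "\<And>i. i \<in> A \<Longrightarrow> f i \<in> I"
  shows "sum f A \<in> I"
proof -
  have "0 \<in> I" and "\<And>x y. x \<in> I \<Longrightarrow> y \<in> I \<Longrightarrow> x + y \<in> I"
    using assms(1) unfolding ideal_of_def by blast+
  then show ?thesis
    using assms(2) by (induction A rule: infinite_finite_induct) simp_all
qed

definition prime_ideal_of :: "'a::comm_ring_1 set \<Rightarrow> 'a set \<Rightarrow> bool" where
  "prime_ideal_of R P \<longleftrightarrow> ideal_of R P \<and> 1 \<notin> P \<and> (\<forall>x\<in>R. \<forall>y\<in>R. x * y \<in> P \<longrightarrow> x \<in> P \<or> y \<in> P)"

text \<open>Zorn's lemma gives an ideal maximal among the proper ideals containing a, and a maximal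
  ideal is prime.\<close>

lemma exists_prime_ideal:
  assumes R: "subring R" and a: "a \<in> R" and nunit: "\<And>x. x \<in> R \<Longrightarrow> a * x \<noteq> 1"
  shows "\<exists>P. prime_ideal_of R P \<and> a \<in> P"
proof -
  define \<A> where "\<A> = {I. ideal_of R I \<and> a \<in> I \<and> 1 \<notin> I}"
  have "\<exists>M\<in>\<A>. \<forall>X\<in>\<A>. M \<subseteq> X \<longrightarrow> X = M"
  proof (rule subset_Zorn_nonempty)
    \<comment> \<open>The principal ideal of a is a first candidate; it is proper because a is not a
      unit of R.\<close>
    have "(\<lambda>x. a * x) ` R \<in> \<A>"
    proof -
      have "ideal_of R ((\<lambda>x. a * x) ` R)"
        unfolding ideal_of_def
      proof (intro conjI ballI)
        show "0 \<in> (\<lambda>x. a * x) ` R"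
          using subringD(2)[OF R] by (force intro: image_eqI[of _ _ 0])
        fix x y assume "x \<in> (\<lambda>x. a * x) ` R" "y \<in> (\<lambda>x. a * x) ` R"
        then show "x + y \<in> (\<lambda>x. a * x) ` R"
          by (auto simp flip: distrib_left intro!: imageI subringD[OF R])
      next
        fix r x assume "r \<in> R" "x \<in> (\<lambda>x. a * x) ` R"
        then show "r * x \<in> (\<lambda>x. a * x) ` R"
          by (auto simp: mult.left_commute intro!: imageI subringD[OF R])
      qed (use a R in \<open>auto intro: subringD\<close>)
      moreover have "a \<in> (\<lambda>x. a * x) ` R"
        using subringD(1)[OF R] by (force intro: image_eqI[of _ _ 1])
      ultimately show ?thesis
        using nunit by (force simp: \<A>_def)
    qed
    then show "\<A> \<noteq> {}" by blast
  next
    fix \<C> assume ne: "\<C> \<noteq> {}" and ch: "subset.chain \<A> \<C>"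
    then have sub: "\<And>I. I \<in> \<C> \<Longrightarrow> ideal_of R I \<and> a \<in> I \<and> 1 \<notin> I"
      and lin: "\<And>I J. I \<in> \<C> \<Longrightarrow> J \<in> \<C> \<Longrightarrow> I \<subseteq> J \<or> J \<subseteq> I"
      by (auto simp: subset_chain_def \<A>_def)
    have "x + y \<in> \<Union>\<C>" if "x \<in> \<Union>\<C>" "y \<in> \<Union>\<C>" for x y
    proof -
      obtain I J where IJ: "I \<in> \<C>" "J \<in> \<C>" "x \<in> I" "y \<in> J"
        using \<open>x \<in> \<Union>\<C>\<close> \<open>y \<in> \<Union>\<C>\<close> by blast
      from lin[OF IJ(1,2)] obtain K where "K \<in> \<C>" "x \<in> K" "y \<in> K"
        using IJ by blast
      then show ?thesis
        using ideal_ofD(3)[OF _ R, of K x y] sub[of K] by blast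
    qed
    moreover have "r * x \<in> \<Union>\<C>" if "r \<in> R" "x \<in> \<Union>\<C>" for r x
      using that ideal_ofD(4)[OF _ R, of _ r x] sub by blast
    moreover have "\<Union>\<C> \<subseteq> R" "0 \<in> \<Union>\<C>" "a \<in> \<Union>\<C>" "1 \<notin> \<Union>\<C>"
      using ne sub ideal_ofD(1,2)[OF _ R] by blast+
    ultimately show "\<Union>\<C> \<in> \<A>"
      unfolding \<A>_def ideal_of_def by simp
  qed
  then obtain P where P: "ideal_of R P" "a \<in> P" "1 \<notin> P"
    and max: "\<And>X. ideal_of R X \<Longrightarrow> a \<in> X \<Longrightarrow> 1 \<notin> X \<Longrightarrow> P \<subseteq> X \<Longrightarrow> X = P"
    by (auto simp: \<A>_def)
  note Pd = ideal_ofD[OF P(1) R] and Rd = subringD[OF R]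
  have "y \<in> P" if x: "x \<in> R" "x \<notin> P" and y: "y \<in> R" "x * y \<in> P" for x y
  proof -
    \<comment> \<open>X is the ideal P + R x, strictly larger than P, so maximality forces 1 into
      it. Multiplying 1 = w + r x by y then shows that y lies in P.\<close>
    define X where "X = {w + r * x |w r. w \<in> P \<and> r \<in> R}"
    have XI: "w + r * x \<in> X" if "w \<in> P" "r \<in> R" for w r
      using that by (auto simp: X_def)
    have "P \<subseteq> X"
      using XI[OF _ Rd(2)] by auto
    have "ideal_of R X"
      unfolding ideal_of_def
    proof (intro conjI ballI)
      show "X \<subseteq> R" using x by (auto simp: X_def intro!: Rd(4,5) dest: Pd(1))
      show "0 \<in> X" using \<open>P \<subseteq> X\<close> Pd(2) by blast
      fix u v assume "u \<in> X" "v \<in> X"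
      then obtain w r w' r' where *: "u = w + r * x" "v = w' + r' * x" "w \<in> P" "w' \<in> P" "r \<in> R" "r' \<in> R"
        by (auto simp: X_def)
      then have "u + v = (w + w') + (r + r') * x" by (simp add: algebra_simps)
      then show "u + v \<in> X" using XI[OF Pd(3) Rd(4)] * by metis
    next
      fix s u assume "s \<in> R" "u \<in> X"
      then obtain w r where *: "u = w + r * x" "w \<in> P" "r \<in> R"
        by (auto simp: X_def)
      then have "s * u = s * w + (s * r) * x" by (simp add: algebra_simps)
      then show "s * u \<in> X" using XI[OF Pd(4) Rd(5)] * \<open>s \<in> R\<close> by metis
    qed
    moreover have "x \<in> X" using XI[OF Pd(2) Rd(1)] by simp
    ultimately have "1 \<in> X"
      using max[of X] P(2) \<open>P \<subseteq> X\<close> x(2) by blast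
    then obtain w r where wr: "1 = w + r * x" "w \<in> P" "r \<in> R"
      by (auto simp: X_def)
    have "y = y * (w + r * x)" using wr(1) by simp
    also have "\<dots> = y * w + r * (x * y)" by (simp add: algebra_simps)
    also have "\<dots> \<in> P" using wr y by (intro Pd(3)[OF Pd(4) Pd(4)])
    finally show "y \<in> P" .
  qed
  then show ?thesis using P unfolding prime_ideal_of_def by blast
qed

section \<open>The Frobenius map modulo p\<close>

text \<open>In the binomial expansion p divides every coefficient except the first and the
  last.\<close>

lemma frobenius_add_prime:
  fixes x y :: "'a::comm_ring_1"
  assumes R: "subring R" and I: "ideal_of R I" and p: "prime p" "of_nat p \<in> I" and "x \<in> R" "y \<in> R"
  shows "(x + y) ^ p - x ^ p - y ^ p \<in> I"
proof -
  note Rc = subring_closed[OF R] and Rd = subringD[OF R] and Id = ideal_ofD[OF I R]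
  let ?f = "\<lambda>k. of_nat (p choose k) * x ^ k * y ^ (p - k)"
  have "p > 0" using p(1) by (simp add: prime_gt_0_nat)
  have "{..p} = insert 0 (insert p {1..<p})" using \<open>p > 0\<close> by auto
  then have "(x + y) ^ p = y ^ p + x ^ p + (\<Sum>k\<in>{1..<p}. ?f k)"
    using \<open>p > 0\<close> by (simp add: binomial_ring)
  then have "(x + y) ^ p - x ^ p - y ^ p = (\<Sum>k\<in>{1..<p}. ?f k)" by simp
  also have "\<dots> \<in> I"
  proof -
    have "?f k \<in> I" if k: "k \<in> {1..<p}" for k
    proof -
      obtain c where "p choose k = p * c"
        using dvd_choose_prime[of k p] p(1) k by (auto elim: dvdE)
      then have "?f k = (of_nat c * x ^ k * y ^ (p - k)) * of_nat p"
        by (simp add: algebra_simps)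
      then show ?thesis
        using assms(5,6) p(2) by (auto intro!: Id(4) Rd(5) Rc(2,3))
    qed
    then show ?thesis
      by (rule ideal_of_sum[OF I])
  qed
  finally show ?thesis .
qed

text \<open>In R the difference x - y divides x^n - y^n, so congruences may be raised to
  powers.\<close>

lemma ideal_of_power_diff:
  fixes x y :: "'a::comm_ring_1"
  assumes R: "subring R" and I: "ideal_of R I" and "x \<in> R" "y \<in> R" "x - y \<in> I"
  shows "x ^ n - y ^ n \<in> I"
proof -
  have "(\<Sum>i<n. y ^ (n - Suc i) * x ^ i) \<in> R"
    using assms(3,4) by (intro subring_closed(1)[OF R] subringD(5)[OF R] subring_closed(2)[OF R])
  then show ?thesis
    unfolding power_diff_sumr2 using ideal_ofD(4)[OF I R _ assms(5)] by (metis mult.commute)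
qed

lemma frobenius_add:
  fixes x y :: "'a::comm_ring_1"
  assumes R: "subring R" and I: "ideal_of R I" and p: "prime p" "of_nat p \<in> I" and xy: "x \<in> R" "y \<in> R"
  shows "(x + y) ^ (p ^ e) - x ^ (p ^ e) - y ^ (p ^ e) \<in> I"
proof (induction e)
  case 0
  then show ?case using ideal_ofD(2)[OF I R] by simp
next
  case (Suc e)
  let ?q = "p ^ e"
  note Rp = subring_closed(2)[OF R] and Ra = subringD(4)[OF R]
  \<comment> \<open>The induction hypothesis raised to the p-th power is combined with one
    application of additivity for p.\<close>
  have "((x + y) ^ ?q) ^ p - (x ^ ?q + y ^ ?q) ^ p \<in> I"
    using Suc xy by (intro ideal_of_power_diff[OF R I] Rp Ra) (simp_all add: diff_diff_eq)
  moreover have "(x ^ ?q + y ^ ?q) ^ p - (x ^ ?q) ^ p - (y ^ ?q) ^ p \<in> I"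
    using xy by (intro frobenius_add_prime[OF R I p] Rp)
  ultimately have "((x + y) ^ ?q) ^ p - (x ^ ?q + y ^ ?q) ^ p
      + ((x ^ ?q + y ^ ?q) ^ p - (x ^ ?q) ^ p - (y ^ ?q) ^ p) \<in> I"
    by (rule ideal_ofD(3)[OF I R])
  also have "((x + y) ^ ?q) ^ p - (x ^ ?q + y ^ ?q) ^ p
      + ((x ^ ?q + y ^ ?q) ^ p - (x ^ ?q) ^ p - (y ^ ?q) ^ p)
      = (x + y) ^ (p ^ Suc e) - x ^ (p ^ Suc e) - y ^ (p ^ Suc e)"
    by (simp only: power_Suc2 power_mult) simp
  finally show ?case .
qed

text \<open>The elements congruent to their q-th power form a ring, by additivity of Frobenius, and
  this ring contains z.\<close>

lemma adjoin_frobenius_fixed: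
  assumes I: "ideal_of (adjoin z) I" and p: "prime p" "of_nat p \<in> I"
    and z: "z ^ (p ^ e) = z" and "x \<in> adjoin z"
  shows "x ^ (p ^ e) - x \<in> I"
  using assms(5)
proof induction
  let ?q = "p ^ e"
  note R = subring_adjoin[of z]
  note Id = ideal_ofD[OF I R] and Rp = subring_closed(2)[OF R] and frob = frobenius_add[OF R I p, where e = e]
  have "p > 0" using p(1) by (simp add: prime_gt_0_nat)
  {
    case one
    show ?case using Id(2) by simp
  next
    case gen
    show ?case using Id(2) z by simp
  next
    case (add x y)
    have "(x + y) ^ ?q - x ^ ?q - y ^ ?q + ((x ^ ?q - x) + (y ^ ?q - y)) \<in> I"
      using add by (intro Id(3) frob) auto
    then show ?case by (simp add: algebra_simps)
  next
    case (uminus x)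
    \<comment> \<open>Additivity applied to x and -x, whose sum has q-th power 0, treats p = 2 and
      odd p alike.\<close>
    have "(x + - x) ^ ?q - x ^ ?q - (- x) ^ ?q + (x ^ ?q - x) \<in> I"
      using uminus by (intro Id(3) frob adjoin.uminus) auto
    then have "- (- ((- x) ^ ?q) - x) \<in> I"
      using \<open>p > 0\<close> by (intro Id(5)) (simp add: power_0_left)
    then show ?case by (simp add: add.commute)
  next
    case (mult x y)
    have "x ^ ?q * (y ^ ?q - y) + y * (x ^ ?q - x) \<in> I"
      using mult by (intro Id(3,4) Rp) auto
    then show ?case by (simp add: algebra_simps power_mult_distrib)
  }
qed

section \<open>Roots of unity as residue classes, and the affine table\<close>

text \<open>Both sides are monic polynomials of degree n in x that agree at the n distinct powers of
  z.\<close>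

lemma power_minus_one_factorization:
  fixes z :: "'a::idom"
  assumes z: "z ^ n = 1" and inj: "inj_on (\<lambda>i. z ^ i) {..<n}" and "0 < n"
  shows "x ^ n - 1 = (\<Prod>i<n. x - z ^ i)"
proof -
  let ?P = "monom 1 n - 1 :: 'a poly" and ?Q = "\<Prod>i<n. [:- (z ^ i), 1:]"
  have "?P = ?Q"
  proof (rule poly_eqI_degree_lead_coeff[where n = n and A = "(\<lambda>i. z ^ i) ` {..<n}"])
    have deg: "degree ?Q = n"
      by (subst degree_prod_eq_sum_degree) auto
    have "coeff ?Q n = lead_coeff ?Q" by (simp only: deg)
    also have "\<dots> = 1" by (simp add: lead_coeff_prod)
    finally show "coeff ?P n = coeff ?Q n" using \<open>0 < n\<close> by simp
    show "degree ?Q \<le> n" using deg by simp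
    show "degree ?P \<le> n" by (intro degree_diff_le degree_monom_le) simp
    show "n \<le> card ((\<lambda>i. z ^ i) ` {..<n})" using inj by (simp add: card_image)
    fix w assume "w \<in> (\<lambda>i. z ^ i) ` {..<n}"
    then obtain i where i: "i < n" "w = z ^ i" by auto
    have "w ^ n = (z ^ n) ^ i" unfolding i(2) by (simp only: mult.commute flip: power_mult)
    then have "poly ?P w = 0" using z by (simp add: poly_monom)
    moreover have "poly ?Q w = 0"
      unfolding poly_prod using i by (intro prod_zero) (auto intro!: bexI[of _ i])
    ultimately show "poly ?P w = poly ?Q w" by simp
  qed
  then have "poly ?P x = poly ?Q x" by simp
  then show ?thesis by (simp add: poly_monom poly_prod)
qed

lemma prime_ideal_prod:
  assumes R: "subring R" and P: "prime_ideal_of R P"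
    and "finite A" "\<And>i. i \<in> A \<Longrightarrow> f i \<in> R" "prod f A \<in> P"
  shows "\<exists>i\<in>A. f i \<in> P"
  using assms(3-5)
proof (induction A rule: finite_induct)
  case empty
  then show ?case using P by (simp add: prime_ideal_of_def)
next
  case (insert a A)
  have "prod f A \<in> R"
    using insert(1) insert.prems(1)
    by (induction A rule: finite_induct) (auto intro: subringD(1,5)[OF R])
  then show ?case
    using insert P by (auto simp: prime_ideal_of_def)
qed

text \<open>The table T r b j is r j + b in a field whose elements are numbered so that 0 is the zero element.\<close>

locale planar_table =
  fixes q :: nat and T :: "nat \<Rightarrow> nat \<Rightarrow> nat \<Rightarrow> nat"
  assumes less: "\<And>r b j. T r b j < q"
    and translate: "\<And>r b b' j. b < q \<Longrightarrow> b' < q \<Longrightarrow> T r b j = T r b' j \<Longrightarrow> b = b'"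
    and inj: "\<And>r b j j'. 0 < r \<Longrightarrow> r < q \<Longrightarrow> j < q \<Longrightarrow> j' < q \<Longrightarrow> T r b j = T r b j' \<Longrightarrow> j = j'"
    and meet: "\<And>r r' b b' j j'. r < q \<Longrightarrow> r' < q \<Longrightarrow> r \<noteq> r' \<Longrightarrow> j < q \<Longrightarrow> j' < q \<Longrightarrow>
      T r b j = T r' b' j \<Longrightarrow> T r b j' = T r' b' j' \<Longrightarrow> j = j'"

text \<open>Two facts make the residue classes of Z[z] modulo P a field with q elements: 0 and the
  powers of z are pairwise incongruent, and every element is congruent to one of them. The
  properties of the table then follow from primality of P.\<close>

lemma planar_table_exists:
  assumes "primepow q"
  shows "\<exists>T. planar_table q T"
proof -
  from assms obtain p e where p: "prime p" and "0 < e" and q: "q = p ^ e"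
    by (auto simp: primepow_def)
  then have "1 < q"
    using one_less_power[OF prime_gt_1_nat[OF p]] by simp
  define n where "n = q - 1"
  define z where "z = cis (2 * pi / real n)"
  have n: "0 < n" "Suc n = q" using \<open>1 < q\<close> by (auto simp: n_def)
  have zpow: "z ^ i = cis (2 * pi * real i / real n)" for i
    by (simp add: z_def DeMoivre mult_ac)
  have inj: "inj_on (\<lambda>i. z ^ i) {..<n}" and zn: "z ^ n = 1"
    using bij_betw_roots_unity[OF n(1)] n(1) by (auto simp: zpow bij_betw_def)
  let ?R = "adjoin z"
  note R = subring_adjoin[of z]
  note Rd = subringD[OF R] and Rc = subring_closed[OF R]
  obtain P where P': "prime_ideal_of ?R P" "of_nat p \<in> P"
    using exists_prime_ideal[OF R Rc(3) nat_not_unit_adjoin[OF n(1) zn _ prime_gt_1_nat[OF p]]] by blast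
  then have P: "ideal_of ?R P" "of_nat p \<in> P" "1 \<notin> P"
    and prime: "\<And>x y. x \<in> ?R \<Longrightarrow> y \<in> ?R \<Longrightarrow> x * y \<in> P \<Longrightarrow> x \<in> P \<or> y \<in> P"
    by (auto simp: prime_ideal_of_def)
  note Pd = ideal_ofD[OF P(1) R]
  have zR: "z ^ i \<in> ?R" for i
    by (intro Rc(2) adjoin.gen)
  \<comment> \<open>Powers of z are units, with inverse z^(n i - i), so a proper ideal contains none
    of them.\<close>
  have power_notin: "z ^ i \<notin> P" for i
  proof
    assume *: "z ^ i \<in> P"
    have "z ^ i * z ^ (n * i - i) = z ^ (n * i)"
      using n(1) by (simp flip: power_add)
    also have "\<dots> = 1" by (simp add: power_mult zn)
    finally have "z ^ (n * i - i) * z ^ i = 1" by (simp add: mult.commute)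
    then show False using Pd(4)[OF zR *, of "n * i - i"] P(3) by simp
  qed
  \<comment> \<open>If two powers were congruent, then w = z^(j-i) would be congruent to 1, and the
    sum of 1 - w^l over l < n would lie in P. That sum equals n because the geometric sum of w
    vanishes; as q = n + 1 also lies in P, so would 1.\<close>
  have power_diff_notin: "z ^ i - z ^ j \<notin> P" if "i < j" "j < n" for i j
  proof
    assume *: "z ^ i - z ^ j \<in> P"
    let ?w = "z ^ (j - i)"
    have "z ^ i - z ^ j = z ^ i * (1 - ?w)"
      using that by (simp add: algebra_simps flip: power_add)
    then have "1 - ?w \<in> P"
      using * prime[of "z ^ i" "1 - ?w"] power_notin Rd(6)[OF Rd(1) zR] zR by auto
    then have "?w - 1 \<in> P" using Pd(5)[of "1 - ?w"] by simp
    then have "?w ^ l - 1 ^ l \<in> P" for l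
      by (rule ideal_of_power_diff[OF R P(1) zR Rd(1)])
    then have "(\<Sum>l<n. 1 - ?w ^ l) \<in> P"
      using Pd(5) by (intro ideal_of_sum[OF P(1)]) (metis minus_diff_eq power_one)
    moreover have "(\<Sum>l<n. ?w ^ l) = 0"
    proof -
      have "?w \<noteq> 1"
        using inj_onD[OF inj, of "j - i" 0] that n(1) by (auto simp: less_imp_diff_less)
      moreover have "?w ^ n = 1"
        by (simp add: power_mult[symmetric] mult.commute[of _ n]) (simp add: power_mult zn)
      ultimately show ?thesis by (simp add: geometric_sum)
    qed
    ultimately have "of_nat n \<in> P" by (simp add: sum_subtractf)
    moreover have "of_nat q \<in> P"
    proof -
      have "of_nat q = of_nat (p ^ (e - 1)) * (of_nat p :: complex)"
        using \<open>0 < e\<close> unfolding q by (cases e) auto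
      then show ?thesis using Pd(4)[OF Rc(3) P(2)] by metis
    qed
    ultimately have "of_nat q - of_nat n \<in> P" by (intro Pd(6))
    then show False using P(3) by (simp flip: n(2))
  qed
  \<comment> \<open>Number 0 is the zero element; the shift by one places the n powers of z at
    numbers 1 to q - 1.\<close>
  define el where "el k = (if k = 0 then 0 else z ^ (k - 1))" for k :: nat
  have elR: "el k \<in> ?R" for k
    by (simp add: el_def Rd(2) zR)
  have el_inj: "i = j" if "el i - el j \<in> P" "i < q" "j < q" for i j
  proof (rule ccontr)
    assume "i \<noteq> j"
    have "el i - el j \<notin> P" if "i < j" "j < q" for i j
    proof (cases "i = 0")
      case True
      then show ?thesis using that power_notin[of "j - 1"] Pd(5)[of "- (z ^ (j - 1))"] by (auto simp: el_def)
    next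
      case False
      then show ?thesis using that power_diff_notin[of "i - 1" "j - 1"] n by (auto simp: el_def)
    qed
    from this[of i j] this[of j i] show False
      using that \<open>i \<noteq> j\<close> Pd(5)[of "el i - el j"] by (cases "i < j") auto
  qed
  \<comment> \<open>Frobenius puts x^q - x into P. It is the product of all x - \<open>el k\<close>,
    so primality puts one factor into P.\<close>
  have el_surj: "\<exists>k<q. x - el k \<in> P" if x: "x \<in> ?R" for x
  proof -
    have "z ^ (p ^ e) = z" by (simp add: zn flip: q n(2))
    then have "x ^ q - x \<in> P"
      unfolding q by (rule adjoin_frobenius_fixed[OF P(1) p P(2) _ x])
    also have "x ^ q - x = x * (\<Prod>i<n. x - z ^ i)"
      unfolding power_minus_one_factorization[OF zn inj n(1), symmetric] n(2)[symmetric]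
      by (simp add: algebra_simps)
    also have "\<dots> = (\<Prod>k<q. x - el k)"
      unfolding n(2)[symmetric] prod.lessThan_Suc_shift by (simp add: el_def)
    finally have "(\<Prod>k<q. x - el k) \<in> P" .
    then have "\<exists>k\<in>{..<q}. x - el k \<in> P"
      by (intro prime_ideal_prod[OF R P'(1)]) (auto intro: Rd(6) x elR)
    then show ?thesis by auto
  qed
  define rep where "rep x = (SOME k. k < q \<and> x - el k \<in> P)" for x
  have rep: "rep x < q" "x - el (rep x) \<in> P" if "x \<in> ?R" for x
    using someI_ex[OF el_surj[OF that]] by (auto simp: rep_def)
  have rep_eq: "x - y \<in> P" if "rep x = rep y" "x \<in> ?R" "y \<in> ?R" for x y
    using Pd(6)[OF rep(2)[OF that(2)] rep(2)[OF that(3)]] that(1) by simp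
  define T where "T r b j = rep (el r * el j + el b)" for r b j
  have TR: "el r * el j + el b \<in> ?R" for r b j
    by (intro Rd(4,5) elR)
  have "planar_table q T"
  proof (rule planar_table.intro)
    show "T r b j < q" for r b j
      unfolding T_def by (rule rep(1)[OF TR])
    show "b = b'" if "b < q" "b' < q" "T r b j = T r b' j" for r b b' j
      using rep_eq[OF that(3)[unfolded T_def] TR TR] that(1,2) by (intro el_inj) auto
    show "j = j'" if "0 < r" "r < q" "j < q" "j' < q" "T r b j = T r b j'" for r b j j'
    proof -
      have "el r * (el j - el j') \<in> P"
        using rep_eq[OF that(5)[unfolded T_def] TR TR] by (simp add: algebra_simps)
      moreover have "el r \<notin> P"
        using that power_notin by (auto simp: el_def)
      ultimately show ?thesis
        using prime[OF elR Rd(6)[OF elR elR]] el_inj that(3,4) by blast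
    qed
    show "j = j'" if *: "r < q" "r' < q" "r \<noteq> r'" "j < q" "j' < q"
      "T r b j = T r' b' j" "T r b j' = T r' b' j'" for r r' b b' j j'
    proof -
      \<comment> \<open>Subtracting the two congruences cancels the intercepts and leaves (r - r')(j
        - j') in field terms.\<close>
      have "(el r * el j + el b - (el r' * el j + el b'))
          - (el r * el j' + el b - (el r' * el j' + el b')) \<in> P"
        using rep_eq[OF *(6)[unfolded T_def] TR TR] rep_eq[OF *(7)[unfolded T_def] TR TR]
        by (rule Pd(6))
      then have "(el r - el r') * (el j - el j') \<in> P" by (simp add: algebra_simps)
      then show ?thesis
        using prime[OF Rd(6)[OF elR elR] Rd(6)[OF elR elR]] el_inj *(1-5) by blast
    qed
  qed
  then show ?thesis by blast
qed

section \<open>Quasi-unbiased unit weighing matrices\<close>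

lemma sum_mult_lessThan:
  fixes f :: "nat \<Rightarrow> 'a::comm_monoid_add"
  shows "(\<Sum>l<m * q. f l) = (\<Sum>i<m. \<Sum>b<q. f (i * q + b))"
proof -
  have "(\<Sum>b<q. f (i * q + b)) = sum f {i * q..<i * q + q}" for i
    using sum.shift_bounds_nat_ivl[of f 0 "i * q" q] by (simp add: add.commute lessThan_atLeast0)
  then show ?thesis by (simp add: sum.nat_group)
qed

lemma index_less: "i < m \<Longrightarrow> b < q \<Longrightarrow> i * q + b < m * (q::nat)"
  using mult_le_mono1[of "Suc i" m q] by simp

text \<open>The identity W W^* = k I makes W^*/k a right inverse of a square matrix, hence also a
  left inverse, so the columns are orthogonal too.\<close>

lemma unit_weighing_columns:
  assumes W: "unit_weighing n k W" and "0 < k" "p < n" "r < n"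
  shows "(\<Sum>l<n. cnj (W l p) * W l r) = (if p = r then of_nat k else 0)"
proof -
  define A where "A = mat n n (\<lambda>(i, j). W i j)"
  define B where "B = mat n n (\<lambda>(i, j). cnj (W j i) / of_nat k)"
  have car: "A \<in> carrier_mat n n" "B \<in> carrier_mat n n"
    by (auto simp: A_def B_def)
  have "A * B = 1\<^sub>m n"
  proof (rule eq_matI)
    fix i j assume "i < dim_row (1\<^sub>m n :: complex mat)" "j < dim_col (1\<^sub>m n :: complex mat)"
    then have ij: "i < n" "j < n" by auto
    then have "(A * B) $$ (i, j) = mult_adj n W W i j / of_nat k"
      by (simp add: A_def B_def scalar_prod_def mult_adj_def sum_divide_distrib lessThan_atLeast0)
    then show "(A * B) $$ (i, j) = 1\<^sub>m n $$ (i, j)"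
      using W \<open>0 < k\<close> ij by (simp add: unit_weighing_def)
  qed (use car in auto)
  then have "(B * A) $$ (p, r) = 1\<^sub>m n $$ (p, r)"
    using mat_mult_left_right_inverse[OF car] by simp
  moreover have "(B * A) $$ (p, r) = (\<Sum>l<n. cnj (W l p) * W l r) / of_nat k"
    using assms(3,4) by (simp add: A_def B_def scalar_prod_def sum_divide_distrib lessThan_atLeast0)
  ultimately show ?thesis
    using assms(2-4) by (auto simp: field_simps split: if_splits)
qed

text \<open>Since B^* B = w I, the product A B^* times its adjoint is A (B^* B) A^* = w^2 I. Only
  the entries of A B^* and the arithmetic l a = w^2 remain to be checked.\<close>

lemma quasi_unbiasedI:
  assumes A: "unit_weighing n w A" and B: "unit_weighing n w B" and "0 < w"
    and entry: "\<And>i j. i < n \<Longrightarrow> j < n \<Longrightarrow> entry_unit_or_zero (mult_adj n A B i j / of_real (sqrt a))"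
    and "0 < a" "real l * a = (real w)\<^sup>2"
  shows "quasi_unbiased n w l a A B"
proof -
  have "mult_adj n (\<lambda>i j. mult_adj n A B i j / of_real (sqrt a))
      (\<lambda>i j. mult_adj n A B i j / of_real (sqrt a)) i j = (if i = j then of_nat l else 0)"
    (is "?lhs = _") if ij: "i < n" "j < n" for i j
  proof -
    have "(\<Sum>l<n. mult_adj n A B i l * cnj (mult_adj n A B j l))
      = (\<Sum>l<n. \<Sum>p<n. \<Sum>r<n. A i p * cnj (A j r) * (cnj (B l p) * B l r))"
      by (simp add: mult_adj_def sum_product mult_ac)
    \<comment> \<open>Reordering the sums isolates the inner products of the columns of B.\<close>
    also have "\<dots> = (\<Sum>p<n. \<Sum>r<n. A i p * cnj (A j r) * (\<Sum>l<n. cnj (B l p) * B l r))"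
      unfolding sum_distrib_left by (subst sum.swap, rule sum.cong[OF refl], rule sum.swap)
    also have "\<dots> = (\<Sum>p<n. A i p * cnj (A j p) * of_nat w)"
      by (intro sum.cong refl)
        (simp add: unit_weighing_columns[OF B \<open>0 < w\<close>] if_distrib cong: if_cong)
    also have "\<dots> = mult_adj n A A i j * of_nat w"
      by (simp add: mult_adj_def sum_distrib_right)
    also have "\<dots> = (if i = j then of_nat w * of_nat w else 0)"
      using A ij by (simp add: unit_weighing_def)
    finally have *: "(\<Sum>l<n. mult_adj n A B i l * cnj (mult_adj n A B j l)) = \<dots>" .
    have sq: "complex_of_real (sqrt a) * of_real (sqrt a) = of_real a"
      using \<open>0 < a\<close> by (simp flip: of_real_mult)
    have "?lhs = (\<Sum>l<n. mult_adj n A B i l * cnj (mult_adj n A B j l)) / of_real a"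
      by (simp add: mult_adj_def[of n "\<lambda>i j. mult_adj n A B i j / of_real (sqrt a)"] sum_divide_distrib
          flip: sq)
    also have "\<dots> = (if i = j then of_real ((real w)\<^sup>2) / of_real a else 0)"
      unfolding * by (simp add: power2_eq_square)
    also have "\<dots> = (if i = j then of_nat l else 0)"
      using \<open>0 < a\<close> by (simp flip: assms(6))
    finally show ?thesis .
  qed
  then show ?thesis
    using A B entry by (simp add: quasi_unbiased_def unit_weighing_def)
qed

lemma sum_sum_unique:
  fixes f :: "'a \<Rightarrow> 'b \<Rightarrow> 'c::comm_monoid_add"
  assumes "finite A" "finite B" "a \<in> A" "b \<in> B"
    and "\<And>i j. i \<in> A \<Longrightarrow> j \<in> B \<Longrightarrow> Q i j \<longleftrightarrow> i = a \<and> j = b"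
  shows "(\<Sum>i\<in>A. \<Sum>j\<in>B. if Q i j then f i j else 0) = f a b"
proof -
  have "(\<Sum>i\<in>A. \<Sum>j\<in>B. if Q i j then f i j else 0) = (\<Sum>i\<in>A. \<Sum>j\<in>B. if i = a then if j = b then f i j else 0 else 0)"
    using assms(5) by (intro sum.cong refl) auto
  also have "\<dots> = (\<Sum>i\<in>A. if i = a then f i b else 0)"
    using assms(2,4) by (intro sum.cong refl) auto
  also have "\<dots> = f a b"
    using assms(1,3) by simp
  finally show ?thesis .
qed

section \<open>Designs from parallel classes of lines\<close>

text \<open>The j-th point of the b-th line of class r is (X r b j, Y r b j).\<close>

locale line_classes =
  fixes m q :: nat and X Y :: "nat \<Rightarrow> nat \<Rightarrow> nat \<Rightarrow> nat"
  assumes X_less: "\<And>r b j. r < m \<Longrightarrow> b < q \<Longrightarrow> j < m \<Longrightarrow> X r b j < m"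
    and Y_less: "\<And>r b j. r < m \<Longrightarrow> b < q \<Longrightarrow> j < m \<Longrightarrow> Y r b j < q"
    and Y_inj: "\<And>r b j j'. r < m \<Longrightarrow> b < q \<Longrightarrow> j < m \<Longrightarrow> j' < m \<Longrightarrow> Y r b j = Y r b j' \<Longrightarrow> j = j'"
    and parallel: "\<And>r b b' j j'. r < m \<Longrightarrow> b < q \<Longrightarrow> b' < q \<Longrightarrow> j < m \<Longrightarrow> j' < m \<Longrightarrow>
      X r b j = X r b' j' \<Longrightarrow> Y r b j = Y r b' j' \<Longrightarrow> b = b'"
    and meet: "\<And>r r' b b' i i' j j'. r < m \<Longrightarrow> r' < m \<Longrightarrow> r \<noteq> r' \<Longrightarrow> b < q \<Longrightarrow> b' < q \<Longrightarrow>
      i < m \<Longrightarrow> i' < m \<Longrightarrow> j < m \<Longrightarrow> j' < m \<Longrightarrow>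
      X r b i = X r' b' i' \<Longrightarrow> Y r b i = Y r' b' i' \<Longrightarrow>
      X r b j = X r' b' j' \<Longrightarrow> Y r b j = Y r' b' j' \<Longrightarrow> i = j"

locale line_design = line_classes +
  fixes k u :: nat and s :: "nat \<Rightarrow> nat" and W0 c0 :: "nat \<Rightarrow> nat \<Rightarrow> int" and v0 :: "nat \<Rightarrow> nat \<Rightarrow> nat"
  assumes k_pos: "0 < k" and u_pos: "0 < u" and q_pos: "0 < q"
    and weighing: "weighing_matrix m k W0" and design: "orthogonal_design m u s c0 v0"
begin

text \<open>Rows and columns of order m * q are indexed by i * q + b with i < m and b < q. On entries that
  vanish the variable is 1, an arbitrary element of {1..u}.\<close>

definition position :: "nat \<Rightarrow> nat \<Rightarrow> nat \<Rightarrow> nat" where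
  "position r b y = (THE j. j < m \<and> Y r b j = y)"

text \<open>This is the coefficient of L_r (D \<otimes> I) at row (i, b) and column (l, y). Only the
  point of line b with second coordinate y can contribute, and \<open>Y_inj\<close> allows at most
  one; the guard covers lines without such a point, where \<open>position\<close> has no
  meaning.\<close>

definition design_coeff :: "nat \<Rightarrow> nat \<Rightarrow> nat \<Rightarrow> complex" where
  "design_coeff r I J = (let b = I mod q; y = J mod q; j = position r b y in
     if \<exists>j<m. Y r b j = y then of_int (W0 (I div q) j * c0 (X r b j) (J div q)) else 0)"

definition design_var :: "nat \<Rightarrow> nat \<Rightarrow> nat \<Rightarrow> nat" where
  "design_var r I J = (let b = I mod q; y = J mod q in
     if \<exists>j<m. Y r b j = y then v0 (X r b (position r b y)) (J div q) else 1)"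

text \<open>The entry of L_r L_r'^T at (i, b) and (i', b'), summed over the common points of the two
  lines.\<close>

definition gram :: "nat \<Rightarrow> nat \<Rightarrow> nat \<Rightarrow> nat \<Rightarrow> nat \<Rightarrow> nat \<Rightarrow> int" where
  "gram r r' i b i' b' = (\<Sum>j<m. \<Sum>j'<m.
     if X r b j = X r' b' j' \<and> Y r b j = Y r' b' j' then W0 i j * W0 i' j' else 0)"

section \<open>Entries of the designs and their Gram matrices\<close>

lemma position_eq: "r < m \<Longrightarrow> b < q \<Longrightarrow> j < m \<Longrightarrow> position r b (Y r b j) = j"
  unfolding position_def using Y_inj by blast

lemma coeff_entry:
  assumes "r < m" "I < m * q" "J < m * q"
  shows "design_coeff r I J \<in> {-1, 0, 1}" "design_var r I J \<in> {1..u}"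
proof -
  have lt: "I div q < m" "J div q < m" "I mod q < q"
    using assms q_pos by (auto simp: less_mult_imp_div_less)
  have W: "W0 i j \<in> {-1, 0, 1}" "c0 i j \<in> {-1, 0, 1}" "v0 i j \<in> {1..u}" if "i < m" "j < m" for i j
    using that weighing design by (auto simp: weighing_matrix_def orthogonal_design_def)
  show "design_coeff r I J \<in> {-1, 0, 1}"
  proof (cases "\<exists>j<m. Y r (I mod q) j = J mod q")
    case True
    then obtain j where j: "j < m" "J mod q = Y r (I mod q) j" by auto
    have "design_coeff r I J = of_int (W0 (I div q) j * c0 (X r (I mod q) j) (J div q))"
      using True j position_eq[OF assms(1) lt(3) j(1)] by (simp add: design_coeff_def)
    then show ?thesis
      using W(1)[OF lt(1) j(1)] W(2)[OF X_less[OF assms(1) lt(3) j(1)] lt(2)] by auto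
  qed (auto simp: design_coeff_def Let_def)
  show "design_var r I J \<in> {1..u}"
  proof (cases "\<exists>j<m. Y r (I mod q) j = J mod q")
    case True
    then obtain j where j: "j < m" "J mod q = Y r (I mod q) j" by auto
    have "design_var r I J = v0 (X r (I mod q) j) (J div q)"
      using True j position_eq[OF assms(1) lt(3) j(1)] by (simp add: design_var_def)
    then show ?thesis
      using W(3)[OF X_less[OF assms(1) lt(3) j(1)] lt(2)] by auto
  qed (use u_pos in \<open>auto simp: design_var_def Let_def\<close>)
qed

text \<open>Writing the entry as a sum over all points of the line, with at most one surviving term,
  allows products of entries to be expanded and sums exchanged.\<close>

lemma eval_entry:
  assumes "r < m" "b < q" "y < q"
  shows "design_eval (design_coeff r) (design_var r) x (i * q + b) (l * q + y)
    = (\<Sum>j<m. if Y r b j = y then of_real (of_int (W0 i j) * (of_int (c0 (X r b j) l) * x (v0 (X r b j) l))) else 0)"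
proof (cases "\<exists>j<m. Y r b j = y")
  case True
  then obtain j where j: "j < m" "y = Y r b j" by auto
  have "Y r b j' = y \<longleftrightarrow> j' = j" if "j' < m" for j'
    using Y_inj assms j that by auto
  then have "(\<Sum>j<m. if Y r b j = y then of_real (of_int (W0 i j) * (of_int (c0 (X r b j) l) * x (v0 (X r b j) l))) else 0)
      = (\<Sum>j'<m. if j' = j then complex_of_real (of_int (W0 i j') * (of_int (c0 (X r b j') l) * x (v0 (X r b j') l))) else 0)"
    by (intro sum.cong refl) auto
  then show ?thesis
    using True assms j position_eq[OF assms(1,2) j(1)]
    by (simp add: design_eval_def design_coeff_def design_var_def)
next
  case False
  then show ?thesis using assms by (auto simp: design_eval_def design_coeff_def Let_def)
qed

lemma design_rows:
  assumes "a < m" "a' < m"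
  shows "(\<Sum>l<m. (of_int (c0 a l) * x (v0 a l)) * (of_int (c0 a' l) * x (v0 a' l)))
    = (if a = a' then design_form u s x else 0)"
  using conjunct2[OF design[unfolded orthogonal_design_def], rule_format, OF assms, of x]
  unfolding design_form_def .

text \<open>This is D_r D_r'^T = L_r (D D^T \<otimes> I) L_r'^T, where D D^T is the form times the
  identity. All entries are real, so the adjoint is the transpose.\<close>

lemma mult_adj_eval:
  assumes "r < m" "r' < m" "b < q" "b' < q"
  shows "mult_adj (m * q) (design_eval (design_coeff r) (design_var r) x) (design_eval (design_coeff r') (design_var r') x)
    (i * q + b) (i' * q + b') = of_real (design_form u s x * of_int (gram r r' i b i' b'))"
proof -
  let ?E = "\<lambda>a l. of_int (c0 a l) * x (v0 a l)"
  let ?c = "\<lambda>j j'. of_int (W0 i j) * of_int (W0 i' j') :: real"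
  let ?f = "\<lambda>l j j'. (of_int (W0 i j) * ?E (X r b j) l) * (of_int (W0 i' j') * ?E (X r' b' j') l)"
  have "mult_adj (m * q) (design_eval (design_coeff r) (design_var r) x) (design_eval (design_coeff r') (design_var r') x)
      (i * q + b) (i' * q + b')
    = (\<Sum>l<m. \<Sum>y<q. \<Sum>j<m. \<Sum>j'<m. if Y r b j = y then if Y r' b' j' = y then complex_of_real (?f l j j') else 0 else 0)"
    unfolding mult_adj_def sum_mult_lessThan
  proof (intro sum.cong refl)
    fix l y assume "y \<in> {..<q}"
    then have "y < q" by simp
    show "design_eval (design_coeff r) (design_var r) x (i * q + b) (l * q + y)
        * cnj (design_eval (design_coeff r') (design_var r') x (i' * q + b') (l * q + y))
      = (\<Sum>j<m. \<Sum>j'<m. if Y r b j = y then if Y r' b' j' = y then complex_of_real (?f l j j') else 0 else 0)"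
      unfolding eval_entry[OF assms(1,3) \<open>y < q\<close>] eval_entry[OF assms(2,4) \<open>y < q\<close>] cnj_sum sum_product
      by (intro sum.cong refl) simp
  qed
  also have "\<dots> = (\<Sum>l<m. \<Sum>j<m. \<Sum>y<q. \<Sum>j'<m. if Y r b j = y then if Y r' b' j' = y then complex_of_real (?f l j j') else 0 else 0)"
    by (rule sum.cong[OF refl], rule sum.swap)
  also have "\<dots> = (\<Sum>l<m. \<Sum>j<m. \<Sum>j'<m. \<Sum>y<q. if Y r b j = y then if Y r' b' j' = y then complex_of_real (?f l j j') else 0 else 0)"
    by (rule sum.cong[OF refl], rule sum.cong[OF refl], rule sum.swap)
  \<comment> \<open>The sum over y keeps the pairs of points with equal second coordinates, a value
    that \<open>Y_less\<close> places in the range of y.\<close>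
  also have "\<dots> = (\<Sum>l<m. \<Sum>j<m. \<Sum>j'<m. if Y r b j = Y r' b' j' then complex_of_real (?f l j j') else 0)"
    using Y_less[OF assms(1,3)] by (intro sum.cong[OF refl]) auto
  also have "\<dots> = (\<Sum>j<m. \<Sum>l<m. \<Sum>j'<m. if Y r b j = Y r' b' j' then complex_of_real (?f l j j') else 0)"
    by (rule sum.swap)
  also have "\<dots> = (\<Sum>j<m. \<Sum>j'<m. \<Sum>l<m. if Y r b j = Y r' b' j' then complex_of_real (?f l j j') else 0)"
    by (rule sum.cong[OF refl], rule sum.swap)
  also have "\<dots> = (\<Sum>j<m. \<Sum>j'<m. of_real (design_form u s x * of_int
      (if X r b j = X r' b' j' \<and> Y r b j = Y r' b' j' then W0 i j * W0 i' j' else 0)))"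
  proof (intro sum.cong refl)
    fix j j' assume "j \<in> {..<m}" "j' \<in> {..<m}"
    then have less: "X r b j < m" "X r' b' j' < m"
      using X_less assms by auto
    \<comment> \<open>Orthogonality of the rows of D keeps the pairs with equal first coordinates,
      so only common points remain.\<close>
    have "(\<Sum>l<m. ?f l j j') = ?c j j' * (\<Sum>l<m. ?E (X r b j) l * ?E (X r' b' j') l)"
      by (simp add: sum_distrib_left mult_ac)
    then have "(\<Sum>l<m. complex_of_real (?f l j j'))
        = of_real (?c j j' * (if X r b j = X r' b' j' then design_form u s x else 0))"
      unfolding design_rows[OF less] of_real_sum[symmetric] by (rule arg_cong)
    then show "(\<Sum>l<m. if Y r b j = Y r' b' j' then complex_of_real (?f l j j') else 0)
      = of_real (design_form u s x * of_int
          (if X r b j = X r' b' j' \<and> Y r b j = Y r' b' j' then W0 i j * W0 i' j' else 0))"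
      by (cases "Y r b j = Y r' b' j'") (simp_all add: mult_ac)
  qed
  also have "\<dots> = of_real (design_form u s x * of_int (gram r r' i b i' b'))"
    by (simp add: gram_def sum_distrib_left)
  finally show ?thesis .
qed

text \<open>Distinct lines of a class are disjoint, and a line meets itself only at equal positions,
  which leaves the inner product of two rows of the weighing matrix.\<close>

lemma gram_same:
  assumes "r < m" "i < m" "i' < m" "b < q" "b' < q"
  shows "gram r r i b i' b' = (if i = i' \<and> b = b' then int k else 0)"
proof (cases "b = b'")
  case True
  have "gram r r i b i' b' = (\<Sum>j<m. \<Sum>j'<m. if j' = j then W0 i j * W0 i' j' else 0)"
    unfolding gram_def True using Y_inj assms by (intro sum.cong refl if_cong) auto
  also have "\<dots> = (\<Sum>j<m. W0 i j * W0 i' j)" by simp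
  finally show ?thesis
    using weighing assms True by (simp add: weighing_matrix_def)
next
  case False
  then have "\<not> (X r b j = X r b' j' \<and> Y r b j = Y r b' j')" if "j < m" "j' < m" for j j'
    using parallel[OF assms(1,4,5) that] by blast
  then have "gram r r i b i' b' = 0"
    unfolding gram_def by (intro sum.neutral ballI if_not_P) auto
  then show ?thesis using False by simp
qed

text \<open>Lines of different classes share at most one point, so at most one term survives. Its
  positions j and j' depend on the lines alone, not on i and i', which gives rank at most
  one.\<close>

lemma gram_distinct:
  assumes "r < m" "r' < m" "r \<noteq> r'" "b < q" "b' < q"
  shows "(\<forall>i i'. gram r r' i b i' b' = 0) \<or>
    (\<exists>j<m. \<exists>j'<m. \<forall>i i'. gram r r' i b i' b' = W0 i j * W0 i' j')"
proof (cases "\<exists>j<m. \<exists>j'<m. X r b j = X r' b' j' \<and> Y r b j = Y r' b' j'")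
  case True
  then obtain j j' where j: "j < m" "j' < m" "X r b j = X r' b' j'" "Y r b j = Y r' b' j'"
    by auto
  have "X r b l = X r' b' l' \<and> Y r b l = Y r' b' l' \<longleftrightarrow> l = j \<and> l' = j'" if "l < m" "l' < m" for l l'
  proof
    assume *: "X r b l = X r' b' l' \<and> Y r b l = Y r' b' l'"
    then have "l = j"
      using meet[OF assms that j(1,2)] j(3,4) by blast
    moreover have "l' = j'"
      using * j(4) \<open>l = j\<close> by (intro Y_inj[OF assms(2,5) that(2) j(2)]) simp
    ultimately show "l = j \<and> l' = j'" ..
  qed (use j in simp)
  then have "gram r r' i b i' b' = W0 i j * W0 i' j'" for i i'
    unfolding gram_def using j(1,2) by (intro sum_sum_unique) simp_all
  then show ?thesis using j(1,2) by blast
next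
  case False
  then have "gram r r' i b i' b' = 0" for i i'
    unfolding gram_def by (intro sum.neutral ballI if_not_P) auto
  then show ?thesis by blast
qed

lemma gram_distinct_entry:
  assumes "r < m" "r' < m" "r \<noteq> r'" "i < m" "i' < m" "b < q" "b' < q"
  shows "gram r r' i b i' b' \<in> {-1, 0, 1}"
proof -
  have "W0 i j * W0 i' j' \<in> {-1, 0, 1}" if "j < m" "j' < m" for j j'
  proof -
    have "W0 i j \<in> {-1, 0, 1}" "W0 i' j' \<in> {-1, 0, 1}"
      using that weighing assms(4,5) by (simp_all add: weighing_matrix_def)
    then show ?thesis by auto
  qed
  with gram_distinct[OF assms(1-3,6,7)] show ?thesis
    by (elim disjE exE conjE) simp_all
qed

text \<open>For fixed lines the matrix of all gram r r' i b i' b has rank at most one, so it is not k times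
  the identity of order m > 1; hence different classes yield different matrices even if k = 1.\<close>

lemma gram_not_scalar:
  assumes "r < m" "r' < m" "r \<noteq> r'" "b < q"
  obtains i i' where "i < m" "i' < m" "gram r r' i b i' b \<noteq> (if i = i' then int k else 0)"
proof -
  have "\<not> (\<forall>i<m. \<forall>i'<m. gram r r' i b i' b = (if i = i' then int k else 0))"
  proof
    assume *: "\<forall>i<m. \<forall>i'<m. gram r r' i b i' b = (if i = i' then int k else 0)"
    \<comment> \<open>Two different classes force m > 1, so rows 0 and 1 exist. A product W0 i j *
      W0 i' j' that is nonzero at (0, 0) and (1, 1) cannot vanish at (0, 1).\<close>
    have "0 < m" "1 < m" using assms(1-3) by linarith+
    then have vals: "gram r r' 0 b 0 b = int k" "gram r r' 1 b 1 b = int k" "gram r r' 0 b 1 b = 0"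
      using * by auto
    from gram_distinct[OF assms assms(4)] show False
    proof (elim disjE exE conjE)
      assume "\<forall>i i'. gram r r' i b i' b = 0"
      then show False using vals(1) k_pos by simp
    next
      fix j j' assume "\<forall>i i'. gram r r' i b i' b = W0 i j * W0 i' j'"
      then show False using vals k_pos by auto
    qed
  qed
  then show ?thesis using that by blast
qed

section \<open>The two families\<close>

lemma eval_distinct:
  assumes "r < m" "r' < m" "r \<noteq> r'" "design_form u s x \<noteq> 0"
  shows "\<exists>I<m * q. \<exists>J<m * q. design_eval (design_coeff r) (design_var r) x I J \<noteq> design_eval (design_coeff r') (design_var r') x I J"
proof (rule ccontr)
  let ?D = "\<lambda>r. design_eval (design_coeff r) (design_var r) x"
  assume "\<not> ?thesis"
  then have "mult_adj (m * q) (?D r) (?D r') I J = mult_adj (m * q) (?D r) (?D r) I J" if "J < m * q" for I J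
    using that by (simp add: mult_adj_def)
  then have "gram r r' i 0 i' 0 = gram r r i 0 i' 0" if "i < m" "i' < m" for i i'
    using mult_adj_eval[of r r' 0 0 x i i'] mult_adj_eval[of r r 0 0 x i i'] index_less[OF that(2) q_pos]
      q_pos assms by simp
  moreover obtain i i' where "i < m" "i' < m" "gram r r' i 0 i' 0 \<noteq> (if i = i' then int k else 0)"
    using gram_not_scalar[OF assms(1-3) q_pos] .
  ultimately show False
    using gram_same[OF assms(1) _ _ q_pos q_pos, of i i'] by simp
qed

lemma mult_adj_index:
  assumes "r < m" "r' < m"
  shows "mult_adj (m * q) (design_eval (design_coeff r) (design_var r) x) (design_eval (design_coeff r') (design_var r') x) I J
    = of_real (design_form u s x * of_int (gram r r' (I div q) (I mod q) (J div q) (J mod q)))"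
  using mult_adj_eval[OF assms, of "I mod q" "J mod q" x "I div q" "J div q"] q_pos by simp

lemma design_form_scaled: "design_form u (\<lambda>t. k * s t) x = real k * design_form u s x"
  by (simp add: design_form_def sum_distrib_left mult_ac)

lemma unit_design:
  assumes "r < m"
  shows "unit_orthogonal_design (m * q) u (\<lambda>t. k * s t) (design_coeff r) (design_var r)"
  unfolding unit_orthogonal_design_def
proof (intro conjI allI impI)
  fix I J assume IJ: "I < m * q" "J < m * q"
  show "entry_unit_or_zero (design_coeff r I J)" "design_var r I J \<in> {1..u}"
    using coeff_entry[OF assms IJ] by (auto simp: entry_unit_or_zero_def)
  fix x
  have "I div q = J div q \<and> I mod q = J mod q \<longleftrightarrow> I = J"
    by (metis div_mult_mod_eq)
  moreover have "I div q < m" "J div q < m"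
    using IJ by (auto simp: less_mult_imp_div_less)
  ultimately show "mult_adj (m * q) (design_eval (design_coeff r) (design_var r) x) (design_eval (design_coeff r) (design_var r) x) I J =
      (if I = J then of_real (design_form u (\<lambda>t. k * s t) x) else 0)"
    using q_pos assms by (auto simp: mult_adj_index gram_same design_form_scaled)
qed

lemma gram_index_entry:
  assumes "r < m" "r' < m" "r \<noteq> r'" "I < m * q" "J < m * q"
  shows "entry_unit_or_zero (of_int (gram r r' (I div q) (I mod q) (J div q) (J mod q)))"
proof -
  have "I div q < m" "J div q < m"
    using assms by (auto simp: less_mult_imp_div_less)
  then show ?thesis
    using gram_distinct_entry[OF assms(1-3), of "I div q" "J div q" "I mod q" "J mod q"] q_pos
    by (auto simp: entry_unit_or_zero_def)
qed

lemma unbiased: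
  assumes "r < m" "r' < m" "r \<noteq> r'"
  shows "unbiased_designs (m * q) u (\<lambda>t. k * s t) (real (k\<^sup>2)) (design_coeff r) (design_var r) (design_coeff r') (design_var r')"
  unfolding unbiased_designs_def
proof (intro conjI)
  \<comment> \<open>The factor k in the type cancels against the square root of k^2, so W can be
    taken as L_r L_r'^T.\<close>
  have "design_form u (\<lambda>t. k * s t) x / sqrt (real (k\<^sup>2)) = design_form u s x" for x
    using k_pos by (simp add: design_form_scaled)
  then show "\<exists>W. (\<forall>I<m * q. \<forall>J<m * q. entry_unit_or_zero (W I J)) \<and>
      (\<forall>x. \<forall>I<m * q. \<forall>J<m * q.
        mult_adj (m * q) (design_eval (design_coeff r) (design_var r) x) (design_eval (design_coeff r') (design_var r') x) I J =
        of_real (design_form u (\<lambda>t. k * s t) x / sqrt (real (k\<^sup>2))) * W I J)"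
    using gram_index_entry[OF assms] assms
    by (intro exI[of _ "\<lambda>I J. of_int (gram r r' (I div q) (I mod q) (J div q) (J mod q))"])
      (simp add: mult_adj_index)
qed (use unit_design assms k_pos in auto)

lemma designs_mutually_unbiased:
  assumes "\<forall>t\<in>{1..u}. s t > 0"
  shows "mutually_unbiased_designs m (m * q) u (\<lambda>t. k * s t) (real (k\<^sup>2)) design_coeff design_var"
proof -
  \<comment> \<open>Evaluation with all variables equal to 1 has a nonzero form and so separates the
    designs.\<close>
  have "design_form u s (\<lambda>_. 1) > 0"
    unfolding design_form_def using assms u_pos by (intro sum_pos) auto
  then have "\<exists>x. \<exists>I<m * q. \<exists>J<m * q. design_eval (design_coeff r) (design_var r) x I J \<noteq> design_eval (design_coeff r') (design_var r') x I J"
    if "r < m" "r' < m" "r \<noteq> r'" for r r'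
    using eval_distinct[OF that, of "\<lambda>_. 1"] by auto
  then show ?thesis
    using unit_design unbiased unfolding mutually_unbiased_designs_def by simp
qed

text \<open>Under the indicator function of S the entries become 0, 1 or -1 and the form of D
  becomes w, the sum of s over S. Hence D_r D_r'^T = w L_r L_r'^T, and dividing by sqrt a = w leaves
  the entries of L_r L_r'^T.\<close>

lemma evaluations_mutually_quasi_unbiased:
  assumes pos: "\<forall>t\<in>{1..u}. s t > 0" and S: "S \<noteq> {}" "S \<subseteq> {1..u}"
  shows "mutually_quasi_unbiased m (m * q) (k * (\<Sum>t\<in>S. s t)) (k\<^sup>2) (real ((\<Sum>t\<in>S. s t)\<^sup>2))
    (\<lambda>r. design_eval (design_coeff r) (design_var r) (of_bool \<circ> (\<lambda>t. t \<in> S)))"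
proof -
  let ?x = "of_bool \<circ> (\<lambda>t. t \<in> S) :: nat \<Rightarrow> real"
  let ?w = "\<Sum>t\<in>S. s t"
  let ?D = "\<lambda>r. design_eval (design_coeff r) (design_var r) ?x"
  have fin: "finite S" using S finite_subset by blast
  have "0 < ?w" using pos S(2) by (intro sum_pos fin S(1)) blast
  have form: "design_form u s ?x = real ?w"
  proof -
    have "design_form u s ?x = (\<Sum>t\<in>{1..u}. if t \<in> S then real (s t) else 0)"
      unfolding design_form_def by (intro sum.cong) auto
    also have "\<dots> = (\<Sum>t\<in>{1..u} \<inter> S. real (s t))" by (simp add: sum.inter_restrict)
    finally show ?thesis using S(2) by (simp add: Int_absorb1)
  qed
  have uw: "unit_weighing (m * q) (k * ?w) (?D r)" if "r < m" for r
    unfolding unit_weighing_def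
  proof (intro conjI allI impI)
    fix I J assume "I < m * q" "J < m * q"
    then show "entry_unit_or_zero (?D r I J)"
      using coeff_entry[OF that, of I J] by (auto simp: design_eval_def entry_unit_or_zero_def)
    show "mult_adj (m * q) (?D r) (?D r) I J = (if I = J then of_nat (k * ?w) else 0)"
      using unit_design[OF that] \<open>I < m * q\<close> \<open>J < m * q\<close> form
      by (simp add: unit_orthogonal_design_def design_form_scaled)
  qed
  have "quasi_unbiased (m * q) (k * ?w) (k\<^sup>2) (real (?w\<^sup>2)) (?D r) (?D r')" if r: "r < m" "r' < m" "r \<noteq> r'" for r r'
  proof (rule quasi_unbiasedI[OF uw[OF r(1)] uw[OF r(2)]])
    show "entry_unit_or_zero (mult_adj (m * q) (?D r) (?D r') I J / of_real (sqrt (real (?w\<^sup>2))))"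
      if "I < m * q" "J < m * q" for I J
    proof -
      have "sqrt (real (?w\<^sup>2)) = real ?w"
        by (simp only: of_nat_power real_sqrt_abs abs_of_nat)
      then have "mult_adj (m * q) (?D r) (?D r') I J / of_real (sqrt (real (?w\<^sup>2)))
          = of_int (gram r r' (I div q) (I mod q) (J div q) (J mod q))"
        using \<open>0 < ?w\<close> by (simp add: mult_adj_index[OF r(1,2)] form del: of_nat_sum)
      then show ?thesis
        using gram_index_entry[OF r that] by simp
    qed
    show "real (k\<^sup>2) * real (?w\<^sup>2) = (real (k * ?w))\<^sup>2"
      by (simp add: power_mult_distrib)
  qed (use k_pos \<open>0 < ?w\<close> in \<open>simp_all del: of_nat_sum\<close>)
  moreover have "\<exists>I<m * q. \<exists>J<m * q. ?D r I J \<noteq> ?D r' I J" if "r < m" "r' < m" "r \<noteq> r'" for r r'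
    using eval_distinct[OF that, of ?x] \<open>0 < ?w\<close> unfolding form by (metis of_nat_0_eq_iff less_irrefl)
  ultimately show ?thesis
    using uw unfolding mutually_quasi_unbiased_def by blast
qed

end

text \<open>For m < q, the lines y = r x + b of nonzero slope are used; the second coordinate is then injective
  on each line. For m = q there are too few nonzero slopes, and the lines x = r y + b are used instead.\<close>

lemma (in planar_table) line_classes_exist:
  assumes "m \<le> q"
  shows "\<exists>X Y. line_classes m q X Y"
proof (cases "m = q")
  case True
  \<comment> \<open>The points are (r j + b, j): distinct second coordinates are immediate for every
    slope, including 0, and the first coordinates are in range because m = q.\<close>
  have "line_classes m q T (\<lambda>r b j. j)"
  proof (rule line_classes.intro, goal_cases)
    case 1
    then show ?case by (simp add: less True)
  next
    case 2
    then show ?case by (simp add: True)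
  next
    case 3
    then show ?case by simp
  next
    case (4 r b b' j j')
    then show ?case by (intro translate[of b b' r j]) simp_all
  next
    case (5 r r' b b' i i' j j')
    then show ?case using True by (intro meet[of r r' i j b b']) simp_all
  qed
  then show ?thesis by blast
next
  case False
  then have Suc: "Suc r < q" if "r < m" for r
    using that assms by linarith
  \<comment> \<open>The slopes are 1 to m, all nonzero and below q because m < q.\<close>
  have "line_classes m q (\<lambda>r b j. j) (\<lambda>r. T (Suc r))"
  proof (rule line_classes.intro, goal_cases)
    case 1
    then show ?case by simp
  next
    case 2
    then show ?case by (simp add: less)
  next
    case (3 r b j j')
    then show ?case using assms by (intro inj[of "Suc r" j j' b] Suc) simp_all
  next
    case (4 r b b' j j')
    then show ?case by (intro translate[of b b' "Suc r" j]) simp_all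
  next
    case (5 r r' b b' i i' j j')
    then show ?case using assms by (intro meet[of "Suc r" "Suc r'" i j b b'] Suc) simp_all
  qed
  then show ?thesis by blast
qed

theorem theorem6p2:
  fixes q m k u :: nat and s :: "nat \<Rightarrow> nat"
    and W0 :: "nat \<Rightarrow> nat \<Rightarrow> int" and c0 :: "nat \<Rightarrow> nat \<Rightarrow> int" and v0 :: "nat \<Rightarrow> nat \<Rightarrow> nat"
  assumes "q > 0" "m > 0" "k > 0" "u > 0" "\<forall>t\<in>{1..u}. s t > 0"
    and "primepow q" and "m \<le> q"
    and "weighing_matrix m k W0"
    and "orthogonal_design m u s c0 v0"
  shows "(\<exists>C V. mutually_unbiased_designs m (m * q) u (\<lambda>t. k * s t) (real (k\<^sup>2)) C V) \<and>
         (\<forall>S. S \<noteq> {} \<and> S \<subseteq> {1..u} \<longrightarrow>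
            (\<exists>F. mutually_quasi_unbiased m (m * q) (k * (\<Sum>t\<in>S. s t)) (k\<^sup>2)
                   (real ((\<Sum>t\<in>S. s t)\<^sup>2)) F))"
proof -
  obtain T where "planar_table q T"
    using planar_table_exists[OF assms(6)] by blast
  then obtain X Y where lines: "line_classes m q X Y"
    using planar_table.line_classes_exist[OF _ assms(7)] by blast
  interpret line_design m q X Y k u s W0 c0 v0
    by (rule line_design.intro[OF lines line_design_axioms.intro]) (fact assms)+
  show ?thesis
  proof (intro conjI allI impI)
    show "\<exists>C V. mutually_unbiased_designs m (m * q) u (\<lambda>t. k * s t) (real (k\<^sup>2)) C V"
      using designs_mutually_unbiased[OF assms(5)] by (intro exI)
    fix S assume "S \<noteq> {} \<and> S \<subseteq> {1..u}"
    then show "\<exists>F. mutually_quasi_unbiased m (m * q) (k * (\<Sum>t\<in>S. s t)) (k\<^sup>2)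
        (real ((\<Sum>t\<in>S. s t)\<^sup>2)) F"
      using evaluations_mutually_quasi_unbiased[OF assms(5), of S] by (intro exI) simp
  qed
qed

end
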